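(* Let $0<\alpha\le\beta$, $\kappa=\beta/\alpha$, and let $n\ge 2$ and $d\ge 1$ be integers. Let $f_1,\dots,f_{n-1},f_{\mathrm{a}},f_{\mathrm{b}}\in\mathcal{F}_{\alpha,\beta}$ be functions on $\mathbb{R}^d$, and define $$x^{\mathrm{a}}=\arg\min_{x\in\mathbb{R}^d}\big(f_1(x)+\dots+f_{n-1}(x)+f_{\mathrm{a}}(x)\big),\qquad x^{\mathrm{b}}=\arg\min_{x\in\mathbb{R}^d}\big(f_1(x)+\dots+f_{n-1}(x)+f_{\mathrm{b}}(x)\big).$$ Then $$\|x^{\mathrm{a}}-x^{\mathrm{b}}\|\le\min\left(4+4\sqrt{\kappa},\ \frac{4\sqrt{\kappa}+2\kappa}{\sqrt{n-1}},\ \frac{4\kappa+2\kappa^{3/2}}{n}\right).$$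
   Context: $\|\cdot\|$ is the Euclidean norm. $\mathcal{F}_{\alpha,\beta}$ is the set of continuously differentiable functions $g:\mathbb{R}^d\to\mathbb{R}$ such that: $g$ is $\alpha$-strongly convex (i.e. $g(x)-\frac{\alpha}{2}\|x\|^2$ is convex); $g$ is $\beta$-smooth (i.e. $\|\nabla g(x)-\nabla g(y)\|\le\beta\|x-y\|$ for all $x,y$); $\min_x g(x)=0$; and the minimizer of $g$ has norm at most $1$. *)

theory Defs
  imports "HOL-Analysis.Analysis"
begin

definition strongly_convex :: "real \<Rightarrow> (real ^ 'd \<Rightarrow> real) \<Rightarrow> bool" where
  "strongly_convex \<alpha> g \<longleftrightarrow> convex_on UNIV (\<lambda>x. g x - \<alpha> / 2 * (norm x)\<^sup>2)"

definition is_gradient :: "(real ^ 'd \<Rightarrow> real) \<Rightarrow> (real ^ 'd \<Rightarrow> real ^ 'd) \<Rightarrow> bool" where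
  "is_gradient g g' \<longleftrightarrow> (\<forall>x. GDERIV g x :> g' x)"

text \<open>The last two conjuncts say that the minimum of \<open>g\<close> is attained with value \<open>0\<close>, and that
  the minimizer, which is unique when \<open>0 < \<alpha>\<close>, lies in the closed unit ball.\<close>

definition F_class :: "real \<Rightarrow> real \<Rightarrow> (real ^ 'd \<Rightarrow> real) set" where
  "F_class \<alpha> \<beta> = {g.
     (\<exists>g'. is_gradient g g' \<and> continuous_on UNIV g' \<and>
           (\<forall>x y. norm (g' x - g' y) \<le> \<beta> * norm (x - y))) \<and>
     strongly_convex \<alpha> g \<and>
     (\<exists>z. is_arg_min g (\<lambda>_. True) z \<and> g z = 0) \<and>
     (\<forall>z. is_arg_min g (\<lambda>_. True) z \<longrightarrow> norm z \<le> 1)}"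

end

theory Submission
  imports Defs
begin

text \<open>
  A sum of \<open>n\<close> functions of the class is \<open>n \<alpha>\<close>-strongly convex, is at most \<open>n \<beta> / 2\<close> at the
  origin and at least \<open>n \<alpha> (\<parallel>x\<parallel> - 1)\<^sup>2 / 2\<close> outside the unit ball, so its minimizer has norm at most
  \<open>1 + \<surd>\<kappa>\<close>. This gives the first bound. Adding the quadratic growth inequalities of the two sums at
  \<open>x\<^sup>a\<close> and \<open>x\<^sup>b\<close> cancels the common summands and leaves
  \<open>n \<alpha> \<parallel>x\<^sup>a - x\<^sup>b\<parallel>\<^sup>2 \<le> (f\<^sub>b x\<^sup>a - f\<^sub>b x\<^sup>b) + (f\<^sub>a x\<^sup>b - f\<^sub>a x\<^sup>a)\<close>. Bounding the right-hand side by function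
  values gives the \<open>1 / \<surd>n\<close> rate, bounding it by gradients gives the \<open>1 / n\<close> rate.
\<close>

section \<open>Gradients along lines, at minimizers and of sums\<close>

lemma is_gradient_directional_derivative:
  assumes "is_gradient g g'"
  shows "((\<lambda>t. g (x + t *\<^sub>R v)) has_real_derivative g' (x + t *\<^sub>R v) \<bullet> v) (at t)"
proof -
  have "(g has_derivative (\<lambda>h. h \<bullet> g' (x + t *\<^sub>R v))) (at (x + t *\<^sub>R v))"
    using assms by (simp add: is_gradient_def gderiv_def inner_commute)
  moreover have "((\<lambda>t. x + t *\<^sub>R v) has_derivative (\<lambda>s. s *\<^sub>R v)) (at t)"
    by (auto intro!: derivative_eq_intros)
  ultimately have "((\<lambda>t. g (x + t *\<^sub>R v)) has_derivative
      (\<lambda>s. (s *\<^sub>R v) \<bullet> g' (x + t *\<^sub>R v))) (at t)"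
    by (rule has_derivative_compose[rotated])
  then show ?thesis
    unfolding has_field_derivative_def
    by (rule has_derivative_eq_rhs) (simp add: fun_eq_iff inner_commute)
qed

lemma is_gradient_imp_continuous_on:
  "is_gradient g g' \<Longrightarrow> continuous_on UNIV g"
  by (auto simp: is_gradient_def gderiv_def
      intro!: continuous_at_imp_continuous_on has_derivative_continuous)

lemma is_gradient_eq_0_at_arg_min:
  assumes "is_gradient g g'" "is_arg_min g (\<lambda>_. True) z"
  shows "g' z = 0"
proof -
  have "(g has_derivative (\<lambda>h. h \<bullet> g' z)) (at z)"
    using assms by (simp add: is_gradient_def gderiv_def inner_commute)
  then have "(\<lambda>h. h \<bullet> g' z) = (\<lambda>h. 0)"
    using assms(2) by (intro differential_zero_maxmin[where S = UNIV])
      (auto simp: is_arg_min_def not_less)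
  then show ?thesis
    by (metis inner_eq_zero_iff)
qed

lemma is_gradient_sum:
  assumes "\<And>i. i \<in> S \<Longrightarrow> is_gradient (g i) (g' i)"
  shows "is_gradient (\<lambda>x. \<Sum>i\<in>S. g i x) (\<lambda>x. \<Sum>i\<in>S. g' i x)"
  using assms unfolding is_gradient_def gderiv_def
  by (auto simp: inner_sum_right intro!: has_derivative_sum)

section \<open>Quadratic lower and upper bounds\<close>

lemma strongly_convex_first_order:
  fixes g :: "real ^ 'd \<Rightarrow> real"
  assumes "strongly_convex \<alpha> g" and "is_gradient g g'"
  shows "g x + g' x \<bullet> (y - x) + \<alpha> / 2 * (norm (y - x))\<^sup>2 \<le> g y"
proof -
  \<comment> \<open>The convex function \<open>h\<close> is restricted to the line through
    \<open>x\<close> and \<open>y\<close>, where it lies above its tangent at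
    \<open>t = 0\<close>.\<close>
  define h where "h = (\<lambda>x. g x - \<alpha> / 2 * (norm x)\<^sup>2)"
  define \<phi> where "\<phi> = (\<lambda>t. h (x + t *\<^sub>R (y - x)))"
  have h: "convex_on UNIV h"
    using assms(1) by (simp add: strongly_convex_def h_def)
  have convex: "convex_on UNIV \<phi>"
  proof (rule convex_onI)
    fix t s u :: real assume "0 < t" "t < 1"
    have "x + ((1 - t) * s + t * u) *\<^sub>R (y - x)
        = (1 - t) *\<^sub>R (x + s *\<^sub>R (y - x)) + t *\<^sub>R (x + u *\<^sub>R (y - x))"
      by (simp add: algebra_simps)
    then show "\<phi> ((1 - t) *\<^sub>R s + t *\<^sub>R u) \<le> (1 - t) * \<phi> s + t * \<phi> u"
      using convex_onD[OF h, of t "x + s *\<^sub>R (y - x)" "x + u *\<^sub>R (y - x)"] \<open>0 < t\<close> \<open>t < 1\<close>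
      by (simp add: \<phi>_def)
  qed simp
  have \<phi>_eq: "\<phi> = (\<lambda>t. g (x + t *\<^sub>R (y - x))
      - \<alpha> / 2 * (x \<bullet> x + 2 * t * (x \<bullet> (y - x)) + t\<^sup>2 * ((y - x) \<bullet> (y - x))))"
    unfolding \<phi>_def h_def power2_norm_eq_inner
    by (simp add: fun_eq_iff inner_add_left inner_add_right inner_commute
        power2_eq_square mult.assoc)
  have "(\<phi> has_real_derivative g' x \<bullet> (y - x) - \<alpha> * (x \<bullet> (y - x))) (at 0)"
    unfolding \<phi>_eq using is_gradient_directional_derivative[OF assms(2), of x "y - x" 0]
    by (auto intro!: derivative_eq_intros)
  \<comment> \<open>The tangent is evaluated at \<open>t = 1\<close>. The terms with
    \<open>x \<bullet> (y - x)\<close> then cancel, and the \<open>t\<close> squared term of the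
    subtracted quadratic remains.\<close>
  then have "(g' x \<bullet> (y - x) - \<alpha> * (x \<bullet> (y - x))) * (1 - 0) \<le> \<phi> 1 - \<phi> 0"
    by (intro convex_on_imp_above_tangent[OF convex]) auto
  then show ?thesis
    by (simp add: \<phi>_eq power2_norm_eq_inner inner_diff_left inner_diff_right
        inner_commute[of y x] field_simps)
qed

lemma strongly_convex_sum:
  fixes g :: "'i \<Rightarrow> real ^ 'd \<Rightarrow> real"
  assumes "finite S" "\<And>i. i \<in> S \<Longrightarrow> strongly_convex \<alpha> (g i)"
  shows "strongly_convex (real (card S) * \<alpha>) (\<lambda>x. \<Sum>i\<in>S. g i x)"
proof -
  have "convex_on UNIV (\<lambda>x. \<Sum>i\<in>S. (g i x - \<alpha> / 2 * (norm x)\<^sup>2))"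
    using assms
  proof (induction S rule: finite_induct)
    case empty
    then show ?case by (simp add: convex_on_const)
  next
    case (insert i S)
    then show ?case by (simp add: strongly_convex_def convex_on_add)
  qed
  then show ?thesis
    by (simp add: strongly_convex_def sum_subtractf mult.assoc)
qed

text \<open>The gradient term of the first-order inequality vanishes at a minimizer. Serves both
  single members of the class and whole sums.\<close>

lemma strongly_convex_growth_at_arg_min:
  fixes g :: "real ^ 'd \<Rightarrow> real"
  assumes "strongly_convex \<alpha> g" "is_gradient g g'" "is_arg_min g (\<lambda>_. True) z"
  shows "g z + \<alpha> / 2 * (norm (y - z))\<^sup>2 \<le> g y"
  using strongly_convex_first_order[OF assms(1,2), of z y]
    is_gradient_eq_0_at_arg_min[OF assms(2,3)] by simp

text \<open>The gradient vanishes at \<open>z\<close>, so the Lipschitz condition bounds it at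
  \<open>z + t *\<^sub>R v\<close> by \<open>\<beta> * t * norm v\<close>. Along the segment from
  \<open>z\<close> to \<open>x\<close> the quadratic therefore grows at least as fast as
  \<open>g\<close>.\<close>

lemma smooth_upper_bound_at_arg_min:
  fixes g :: "real ^ 'd \<Rightarrow> real"
  assumes grad: "is_gradient g g'" and min: "is_arg_min g (\<lambda>_. True) z"
    and smooth: "\<And>x y. norm (g' x - g' y) \<le> \<beta> * norm (x - y)"
  shows "g x \<le> g z + \<beta> / 2 * (norm (x - z))\<^sup>2"
proof -
  define v where "v = x - z"
  define \<phi> where "\<phi> = (\<lambda>t. g (z + t *\<^sub>R v) - \<beta> / 2 * t\<^sup>2 * (norm v)\<^sup>2)"
  have deriv: "(\<phi> has_real_derivative g' (z + t *\<^sub>R v) \<bullet> v - \<beta> * t * (norm v)\<^sup>2) (at t)" for t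
    unfolding \<phi>_def using is_gradient_directional_derivative[OF grad, of z v t]
    by (auto intro!: derivative_eq_intros)
  have "g' (z + t *\<^sub>R v) \<bullet> v - \<beta> * t * (norm v)\<^sup>2 \<le> 0" if "0 \<le> t" for t
  proof -
    have "norm (g' (z + t *\<^sub>R v)) \<le> \<beta> * (t * norm v)"
      using smooth[of "z + t *\<^sub>R v" z] is_gradient_eq_0_at_arg_min[OF grad min] that by simp
    then have "norm (g' (z + t *\<^sub>R v)) * norm v \<le> \<beta> * (t * norm v) * norm v"
      by (rule mult_right_mono) simp
    then show ?thesis
      using norm_cauchy_schwarz[of "g' (z + t *\<^sub>R v)" v] by (simp add: power2_eq_square mult.assoc)
  qed
  then have "\<exists>d. (\<phi> has_real_derivative d) (at t) \<and> d \<le> 0" if "0 \<le> t" for t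
    using deriv[of t] that by blast
  then have "\<phi> 1 \<le> \<phi> 0"
    by (intro DERIV_nonpos_imp_nonincreasing[of 0 1 \<phi>]) simp_all
  then show ?thesis
    by (simp add: \<phi>_def v_def)
qed

section \<open>Bounds for single members of the class\<close>

lemma F_classE:
  fixes g :: "real ^ 'd \<Rightarrow> real"
  assumes "g \<in> F_class \<alpha> \<beta>"
  obtains g' z where "is_gradient g g'" "strongly_convex \<alpha> g"
    "\<And>x y. norm (g' x - g' y) \<le> \<beta> * norm (x - y)"
    "is_arg_min g (\<lambda>_. True) z" "g z = 0" "norm z \<le> 1"
  using assms unfolding F_class_def by blast

lemma F_class_nonneg:
  assumes "g \<in> F_class \<alpha> \<beta>"
  shows "0 \<le> g x"
  using assms by (elim F_classE) (metis is_arg_min_linorder)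

text \<open>The minimizer lies in the unit ball, hence within \<open>norm x + 1\<close> of
  \<open>x\<close>. The bound no longer mentions it and so is uniform over the class.\<close>

lemma F_class_upper:
  fixes g :: "real ^ 'd \<Rightarrow> real"
  assumes "g \<in> F_class \<alpha> \<beta>" "0 \<le> \<beta>"
  shows "g x \<le> \<beta> / 2 * (norm x + 1)\<^sup>2"
  using assms(1)
proof (rule F_classE)
  fix g' z
  assume *: "is_gradient g g'" "\<And>x y. norm (g' x - g' y) \<le> \<beta> * norm (x - y)"
    "is_arg_min g (\<lambda>_. True) z" "g z = 0" "norm z \<le> 1"
  have "norm (x - z) \<le> norm x + 1"
    using norm_triangle_ineq4[of x z] *(5) by linarith
  then have "\<beta> / 2 * (norm (x - z))\<^sup>2 \<le> \<beta> / 2 * (norm x + 1)\<^sup>2"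
    using assms(2) by (intro mult_left_mono power_mono) auto
  then show ?thesis
    using smooth_upper_bound_at_arg_min[OF *(1,3,2), of x] *(4) by simp
qed

text \<open>The minimizer is at distance at least \<open>norm x - 1\<close> from \<open>x\<close>;
  \<open>1 \<le> norm x\<close> lets this be squared.\<close>

lemma F_class_lower:
  fixes g :: "real ^ 'd \<Rightarrow> real"
  assumes "g \<in> F_class \<alpha> \<beta>" "0 \<le> \<alpha>" "1 \<le> norm x"
  shows "\<alpha> / 2 * (norm x - 1)\<^sup>2 \<le> g x"
  using assms(1)
proof (rule F_classE)
  fix g' z
  assume *: "is_gradient g g'" "strongly_convex \<alpha> g"
    "is_arg_min g (\<lambda>_. True) z" "g z = 0" "norm z \<le> 1"
  have "norm x - 1 \<le> norm (x - z)"
    using norm_triangle_ineq2[of x z] *(5) by linarith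
  then have "\<alpha> / 2 * (norm x - 1)\<^sup>2 \<le> \<alpha> / 2 * (norm (x - z))\<^sup>2"
    using assms(2,3) by (intro mult_left_mono power_mono) auto
  then show ?thesis
    using strongly_convex_growth_at_arg_min[OF *(2,1,3), of x] *(4) by simp
qed

text \<open>Convexity bounds the difference by \<open>g' x \<bullet> (x - y)\<close>, and
  \<open>g' x\<close> is at most \<open>\<beta>\<close> times the distance from \<open>x\<close> to
  the minimizer, where the gradient vanishes.\<close>

lemma F_class_diff_le:
  fixes g :: "real ^ 'd \<Rightarrow> real"
  assumes "g \<in> F_class \<alpha> \<beta>" "0 \<le> \<alpha>" "0 \<le> \<beta>"
  shows "g x - g y \<le> \<beta> * (norm x + 1) * norm (x - y)"
  using assms(1)
proof (rule F_classE)
  fix g' z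
  assume *: "is_gradient g g'" "strongly_convex \<alpha> g"
    "\<And>x y. norm (g' x - g' y) \<le> \<beta> * norm (x - y)"
    "is_arg_min g (\<lambda>_. True) z" "norm z \<le> 1"
  have "norm (x - z) \<le> norm x + 1"
    using norm_triangle_ineq4[of x z] *(5) by linarith
  then have "\<beta> * norm (x - z) \<le> \<beta> * (norm x + 1)"
    using assms(3) by (rule mult_left_mono)
  then have "norm (g' x) \<le> \<beta> * (norm x + 1)"
    using *(3)[of x z] is_gradient_eq_0_at_arg_min[OF *(1,4)] by simp
  then have "norm (g' x) * norm (x - y) \<le> \<beta> * (norm x + 1) * norm (x - y)"
    by (rule mult_right_mono) simp
  moreover have "g x - g y \<le> g' x \<bullet> (x - y) - \<alpha> / 2 * (norm (y - x))\<^sup>2"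
    using strongly_convex_first_order[OF *(2,1), of x y] by (simp add: inner_diff_right)
  moreover have "0 \<le> \<alpha> / 2 * (norm (y - x))\<^sup>2"
    using assms(2) by simp
  ultimately show ?thesis
    using norm_cauchy_schwarz[of "g' x" "x - y"] by linarith
qed

section \<open>Minimizers of sums\<close>

lemma F_class_sum_gt_at_0:
  fixes g :: "'i \<Rightarrow> real ^ 'd \<Rightarrow> real"
  assumes "finite S" "S \<noteq> {}" "\<And>i. i \<in> S \<Longrightarrow> g i \<in> F_class \<alpha> \<beta>"
    and "0 < \<alpha>" "0 \<le> \<beta>" "1 + sqrt (\<beta> / \<alpha>) < norm x"
  shows "(\<Sum>i\<in>S. g i 0) < (\<Sum>i\<in>S. g i x)"
proof (rule sum_strict_mono[OF assms(1,2)])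
  fix i assume "i \<in> S"
  then have i: "g i \<in> F_class \<alpha> \<beta>" by (rule assms(3))
  have "0 \<le> sqrt (\<beta> / \<alpha>)"
    using assms(4,5) by simp
  \<comment> \<open>The radius is chosen so that beyond it the quadratic lower bound at
    \<open>x\<close> exceeds the upper bound \<open>\<beta> / 2\<close> at the origin, for each
    summand separately.\<close>
  then have "(sqrt (\<beta> / \<alpha>))\<^sup>2 < (norm x - 1)\<^sup>2"
    using assms(6) by (intro power_strict_mono) auto
  then have "\<beta> / 2 < \<alpha> / 2 * (norm x - 1)\<^sup>2"
    using assms(4,5) by (simp add: field_simps)
  moreover have "g i 0 \<le> \<beta> / 2"
    using F_class_upper[OF i assms(5), of 0] by simp
  moreover have "\<alpha> / 2 * (norm x - 1)\<^sup>2 \<le> g i x"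
    using assms(4,6) \<open>0 \<le> sqrt (\<beta> / \<alpha>)\<close> by (intro F_class_lower[OF i]) linarith+
  ultimately show "g i 0 < g i x" by linarith
qed

text \<open>\<open>arg_min\<close> is a choice operator, so existence of a minimizer has to come
  first: continuity gives one on a compact ball, and outside that ball \<open>G\<close> exceeds its
  value at the origin. The same comparison bounds \<open>norm z\<close>.\<close>

lemma F_class_sum_arg_min:
  fixes g :: "'i \<Rightarrow> real ^ 'd \<Rightarrow> real"
  assumes "finite S" "S \<noteq> {}" "\<And>i. i \<in> S \<Longrightarrow> g i \<in> F_class \<alpha> \<beta>"
    and "0 < \<alpha>" "0 \<le> \<beta>"
  defines "G \<equiv> \<lambda>x. \<Sum>i\<in>S. g i x"
  defines "z \<equiv> arg_min G (\<lambda>_. True)"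
  shows "norm z \<le> 1 + sqrt (\<beta> / \<alpha>)"
    and "G z + real (card S) * \<alpha> / 2 * (norm (y - z))\<^sup>2 \<le> G y"
proof -
  have "\<forall>i\<in>S. \<exists>g'. is_gradient (g i) g'"
    using assms(3) by (meson F_classE)
  then obtain g' where "\<And>i. i \<in> S \<Longrightarrow> is_gradient (g i) (g' i)"
    by metis
  then have grad: "is_gradient G (\<lambda>x. \<Sum>i\<in>S. g' i x)"
    unfolding G_def by (rule is_gradient_sum)
  have "\<And>i. i \<in> S \<Longrightarrow> strongly_convex \<alpha> (g i)"
    using assms(3) by (meson F_classE)
  then have convex: "strongly_convex (real (card S) * \<alpha>) G"
    unfolding G_def by (rule strongly_convex_sum[OF assms(1)])
  define r where "r = 1 + sqrt (\<beta> / \<alpha>)"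
  have far: "G 0 < G x" if "r < norm x" for x
    unfolding G_def by (rule F_class_sum_gt_at_0[OF assms(1-5)]) (use that in \<open>auto simp: r_def\<close>)
  have "0 \<le> r"
    using assms(4,5) by (simp add: r_def)
  then have "\<exists>w\<in>cball 0 r. \<forall>x\<in>cball 0 r. G w \<le> G x"
    using is_gradient_imp_continuous_on[OF grad]
    by (intro continuous_attains_inf) (auto intro: continuous_on_subset)
  then obtain w where w: "\<And>x. norm x \<le> r \<Longrightarrow> G w \<le> G x"
    by (metis mem_cball_0)
  have "G w \<le> G x" for x
    using w[of x] w[of 0] far[of x] \<open>0 \<le> r\<close> by fastforce
  then have "is_arg_min G (\<lambda>_. True) w"
    by (simp add: is_arg_min_linorder)
  then have z: "is_arg_min G (\<lambda>_. True) z"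
    unfolding z_def arg_min_def by (rule someI)
  then show "norm z \<le> 1 + sqrt (\<beta> / \<alpha>)"
    using far[of z] by (force simp: is_arg_min_def r_def)
  show "G z + real (card S) * \<alpha> / 2 * (norm (y - z))\<^sup>2 \<le> G y"
    by (rule strongly_convex_growth_at_arg_min[OF convex grad z])
qed

lemma F_class_sum_plus_arg_min:
  fixes f :: "nat \<Rightarrow> real ^ 'd \<Rightarrow> real" and h :: "real ^ 'd \<Rightarrow> real"
  assumes "0 < \<alpha>" "0 \<le> \<beta>" "1 \<le> n" "\<And>i. i \<in> {1..n - 1} \<Longrightarrow> f i \<in> F_class \<alpha> \<beta>"
    and "h \<in> F_class \<alpha> \<beta>"
    and z: "z = arg_min (\<lambda>x. (\<Sum>i=1..n - 1. f i x) + h x) (\<lambda>_. True)"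
  shows "norm z \<le> 1 + sqrt (\<beta> / \<alpha>)"
    and "(\<Sum>i=1..n - 1. f i z) + h z + real n * \<alpha> / 2 * (norm (y - z))\<^sup>2
      \<le> (\<Sum>i=1..n - 1. f i y) + h y"
proof -
  \<comment> \<open>The singled-out function \<open>h\<close> takes index \<open>n\<close>, which
    makes a family of \<open>n\<close> members; \<open>1 \<le> n\<close> keeps the truncated
    \<open>n - 1\<close> from breaking the split.\<close>
  have "{1..n} = insert n {1..n - 1}" "n \<notin> {1..n - 1}"
    using assms(3) by auto
  then have sum_eq: "(\<Sum>i\<in>{1..n}. (f(n := h)) i x) = (\<Sum>i=1..n - 1. f i x) + h x" for x
    by auto
  have "(f(n := h)) i \<in> F_class \<alpha> \<beta>" if "i \<in> {1..n}" for i
    using that assms(4,5) by auto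
  note * = F_class_sum_arg_min[of "{1..n}" "f(n := h)", OF _ _ this assms(1,2),
      unfolded sum_eq, folded z]
  show "norm z \<le> 1 + sqrt (\<beta> / \<alpha>)"
    using *(1) assms(3) by simp
  show "(\<Sum>i=1..n - 1. f i z) + h z + real n * \<alpha> / 2 * (norm (y - z))\<^sup>2
      \<le> (\<Sum>i=1..n - 1. f i y) + h y"
    using *(2)[of y] assms(3) by simp
qed

section \<open>From the growth inequality to distance bounds\<close>

lemma F_class_exchange_value_bound:
  fixes fa fb :: "real ^ 'd \<Rightarrow> real"
  assumes "0 < \<alpha>" "0 \<le> \<beta>" "0 \<le> c" "fa \<in> F_class \<alpha> \<beta>" "fb \<in> F_class \<alpha> \<beta>"
    and "norm xa \<le> 1 + sqrt (\<beta> / \<alpha>)" "norm xb \<le> 1 + sqrt (\<beta> / \<alpha>)"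
    and growth: "c * \<alpha> * (norm (xa - xb))\<^sup>2 \<le> (fb xa - fb xb) + (fa xb - fa xa)"
  shows "sqrt c * norm (xa - xb) \<le> 2 * sqrt (\<beta> / \<alpha>) + \<beta> / \<alpha>"
proof -
  define s where "s = sqrt (\<beta> / \<alpha>)"
  have s: "0 \<le> s" "s\<^sup>2 = \<beta> / \<alpha>"
    using assms(1,2) by (auto simp: s_def)
  have upper: "h x \<le> \<beta> / 2 * (2 + s)\<^sup>2"
    if "h \<in> F_class \<alpha> \<beta>" "norm x \<le> 1 + s" for h :: "real ^ 'd \<Rightarrow> real" and x
  proof -
    have "\<beta> / 2 * (norm x + 1)\<^sup>2 \<le> \<beta> / 2 * (2 + s)\<^sup>2"
      using that(2) assms(2) by (intro mult_left_mono power_mono) auto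
    then show ?thesis
      using F_class_upper[OF that(1) assms(2), of x] by linarith
  qed
  \<comment> \<open>The subtracted values are nonnegative and are dropped; the other two are each at
    most half the right-hand side.\<close>
  have "c * \<alpha> * (norm (xa - xb))\<^sup>2 \<le> \<beta> * (2 + s)\<^sup>2"
    using growth upper[OF assms(5), of xa] upper[OF assms(4), of xb] assms(6,7)
      F_class_nonneg[OF assms(5), of xb] F_class_nonneg[OF assms(4), of xa]
    unfolding s_def by linarith
  \<comment> \<open>Division by \<open>\<alpha>\<close> turns \<open>\<beta>\<close> into the square
    of \<open>s\<close>, so both sides become squares.\<close>
  then have "c * (norm (xa - xb))\<^sup>2 \<le> s\<^sup>2 * (2 + s)\<^sup>2"
    using assms(1) by (simp add: s(2) field_simps)
  then have "(sqrt c * norm (xa - xb))\<^sup>2 \<le> (s * (2 + s))\<^sup>2"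
    using assms(3) by (simp add: power_mult_distrib)
  then have "sqrt c * norm (xa - xb) \<le> s * (2 + s)"
    by (rule power2_le_imp_le) (use s(1) in simp)
  also have "\<dots> = 2 * s + \<beta> / \<alpha>"
    unfolding s(2)[symmetric] by (simp add: power2_eq_square algebra_simps)
  finally show ?thesis
    unfolding s_def .
qed

text \<open>The Lipschitz estimate puts a factor \<open>norm (xa - xb)\<close> on the right as well.
  Cancelling it, when it is nonzero, leaves \<open>c\<close> in place of the \<open>sqrt c\<close>
  of the value bound.\<close>

lemma F_class_exchange_gradient_bound:
  fixes fa fb :: "real ^ 'd \<Rightarrow> real"
  assumes "0 < \<alpha>" "0 \<le> \<beta>" "fa \<in> F_class \<alpha> \<beta>" "fb \<in> F_class \<alpha> \<beta>"
    and "norm xa \<le> r" "norm xb \<le> r"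
    and growth: "c * \<alpha> * (norm (xa - xb))\<^sup>2 \<le> (fb xa - fb xb) + (fa xb - fa xa)"
  shows "c * norm (xa - xb) \<le> 2 * (\<beta> / \<alpha>) * (r + 1)"
proof (cases "xa = xb")
  case True
  have "0 \<le> r"
    using norm_ge_zero[of xa] assms(5) by linarith
  then show ?thesis
    using True assms(1,2) by simp
next
  case False
  have lipschitz: "h x - h y \<le> \<beta> * (r + 1) * norm (x - y)"
    if "h \<in> F_class \<alpha> \<beta>" "norm x \<le> r" for h :: "real ^ 'd \<Rightarrow> real" and x y
  proof -
    have "\<beta> * (norm x + 1) * norm (x - y) \<le> \<beta> * (r + 1) * norm (x - y)"
      using that(2) assms(2) by (intro mult_left_mono mult_right_mono) auto
    then show ?thesis
      using F_class_diff_le[OF that(1) _ assms(2), of x y] assms(1) by linarith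
  qed
  have "c * \<alpha> * (norm (xa - xb))\<^sup>2 \<le> 2 * (\<beta> * (r + 1) * norm (xa - xb))"
    using growth lipschitz[OF assms(4,5), of xb] lipschitz[OF assms(3,6), of xa]
    by (simp add: norm_minus_commute[of xb xa])
  then have "(c * \<alpha> * norm (xa - xb)) * norm (xa - xb) \<le> (2 * \<beta> * (r + 1)) * norm (xa - xb)"
    by (simp add: power2_eq_square mult.assoc)
  then have "c * \<alpha> * norm (xa - xb) \<le> 2 * \<beta> * (r + 1)"
    by (rule mult_right_le_imp_le) (use False in simp)
  then show ?thesis
    using assms(1) by (simp add: field_simps)
qed

theorem theorem2:
  fixes \<alpha> \<beta> \<kappa> :: real
    and n :: nat
    and f :: "nat \<Rightarrow> real ^ 'd \<Rightarrow> real"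
    and fa fb :: "real ^ 'd \<Rightarrow> real"
    and xa xb :: "real ^ 'd"
  assumes "0 < \<alpha>" and "\<alpha> \<le> \<beta>" and "\<kappa> = \<beta> / \<alpha>" and "2 \<le> n"
    and "\<forall>i\<in>{1..n - 1}. f i \<in> F_class \<alpha> \<beta>"
    and "fa \<in> F_class \<alpha> \<beta>" and "fb \<in> F_class \<alpha> \<beta>"
    and "xa = arg_min (\<lambda>x. (\<Sum>i=1..n - 1. f i x) + fa x) (\<lambda>_. True)"
    and "xb = arg_min (\<lambda>x. (\<Sum>i=1..n - 1. f i x) + fb x) (\<lambda>_. True)"
  shows "norm (xa - xb) \<le>
    Min {4 + 4 * sqrt \<kappa>,
         (4 * sqrt \<kappa> + 2 * \<kappa>) / sqrt (real n - 1),
         (4 * \<kappa> + 2 * \<kappa> powr (3 / 2)) / real n}"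
proof -
  have \<beta>: "0 \<le> \<beta>" and \<kappa>: "0 < \<kappa>"
    using assms(1-3) by auto
  note arg_min = F_class_sum_plus_arg_min[OF assms(1) \<beta>, where n = n and f = f]
  have xa: "norm xa \<le> 1 + sqrt \<kappa>" and xb: "norm xb \<le> 1 + sqrt \<kappa>"
    using arg_min(1)[OF _ _ assms(6,8)] arg_min(1)[OF _ _ assms(7,9)] assms(3-5) by auto
  have "(\<Sum>i=1..n - 1. f i xa) + fa xa + real n * \<alpha> / 2 * (norm (xb - xa))\<^sup>2
      \<le> (\<Sum>i=1..n - 1. f i xb) + fa xb"
    using arg_min(2)[OF _ _ assms(6,8)] assms(4,5) by simp
  moreover have "(\<Sum>i=1..n - 1. f i xb) + fb xb + real n * \<alpha> / 2 * (norm (xa - xb))\<^sup>2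
      \<le> (\<Sum>i=1..n - 1. f i xa) + fb xa"
    using arg_min(2)[OF _ _ assms(7,9)] assms(4,5) by simp
  ultimately have growth:
      "real n * \<alpha> * (norm (xa - xb))\<^sup>2 \<le> (fb xa - fb xb) + (fa xb - fa xa)"
    unfolding norm_minus_commute[of xb xa] by simp
  have "0 < sqrt \<kappa>"
    using \<kappa> by simp
  \<comment> \<open>The triangle inequality already gives half of the stated bound.\<close>
  have 1: "norm (xa - xb) \<le> 4 + 4 * sqrt \<kappa>"
    using norm_triangle_ineq4[of xa xb] xa xb \<open>0 < sqrt \<kappa>\<close> by linarith
  \<comment> \<open>The value bound gives the rate with \<open>sqrt n\<close> and half the
    constants; both are weakened to the stated form.\<close>
  have "sqrt (real n - 1) * norm (xa - xb) \<le> sqrt (real n) * norm (xa - xb)"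
    by (intro mult_right_mono) auto
  also have "\<dots> \<le> 2 * sqrt \<kappa> + \<kappa>"
    using F_class_exchange_value_bound[OF assms(1) \<beta> _ assms(6,7) _ _ growth] xa xb assms(3)
    by simp
  also have "\<dots> \<le> 4 * sqrt \<kappa> + 2 * \<kappa>"
    using \<kappa> \<open>0 < sqrt \<kappa>\<close> by linarith
  finally have 2: "norm (xa - xb) \<le> (4 * sqrt \<kappa> + 2 * \<kappa>) / sqrt (real n - 1)"
    using assms(4) by (simp add: pos_le_divide_eq mult.commute)
  \<comment> \<open>Here \<open>r = 1 + sqrt \<kappa>\<close>, and the product expands to exactly
    the stated numerator.\<close>
  have "real n * norm (xa - xb) \<le> 2 * \<kappa> * (1 + sqrt \<kappa> + 1)"
    using F_class_exchange_gradient_bound[OF assms(1) \<beta> assms(6,7) xa xb growth] assms(3) by simp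
  moreover have "\<kappa> powr (3 / 2) = \<kappa> * sqrt \<kappa>"
    using \<kappa> powr_add[of \<kappa> 1 "1 / 2"] by (simp add: powr_half_sqrt)
  ultimately have 3: "norm (xa - xb) \<le> (4 * \<kappa> + 2 * \<kappa> powr (3 / 2)) / real n"
    using assms(4) by (simp add: pos_le_divide_eq algebra_simps)
  show ?thesis
    using 1 2 3 by simp
qed

end
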